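(* Let $X$ be a Banach space, let $f,g\in X^*$, and let $\delta,\varepsilon\in[0,1)$ with $\varepsilon<(1-\delta)^2$. If there exists $x\in S_X$ such that $|f(x)|\ge(1-\delta)\|f\|$ and $|g(x)|\le\frac{\varepsilon}{1-\delta}\|g\|$, then $f\perp_\delta^\varepsilon g$ in $X^*$.
   Context: All normed linear spaces are over $\mathbb{C}$. $X^*$ is the topological dual of $X$ and $S_X$ is the unit sphere of $X$. For a normed linear space $Z$, $\delta,\varepsilon\in[0,1)$ with $\varepsilon<(1-\delta)^2$ and $u,v\in Z$, one writes $u\perp_\delta^\varepsilon v$ (in $Z$) if there exists $\Gamma\in Z^*\setminus\{0\}$ with $|\Gamma(u)|\ge(1-\delta)\|\Gamma\|\|u\|$ and $|\Gamma(v)|\le\frac{\varepsilon}{1-\delta}\|\Gamma\|\|v\|$. Here this is applied with $Z=X^*$, so $\Gamma\in X^{**}$. *)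

theory Defs
  imports "HOL-Analysis.Analysis"
begin

(* The type classes of HOL-Analysis only provide real scalars.  A complex normed space is a real
   normed space whose real scaling extends to a complex scaling with a homogeneous norm; a complex
   Banach space is then a type of sort {complex_normed_vector, banach}. *)

class complex_normed_vector = real_normed_vector +
  fixes scaleC :: "complex \<Rightarrow> 'a \<Rightarrow> 'a"  (infixr "*\<^sub>C" 75)
  assumes scaleC_of_real: "of_real r *\<^sub>C x = r *\<^sub>R x"
    and scaleC_add_right: "a *\<^sub>C (x + y) = a *\<^sub>C x + a *\<^sub>C y"
    and scaleC_add_left: "(a + b) *\<^sub>C x = a *\<^sub>C x + b *\<^sub>C x"
    and scaleC_scaleC: "a *\<^sub>C b *\<^sub>C x = (a * b) *\<^sub>C x"
    and norm_scaleC: "norm (a *\<^sub>C x) = cmod a * norm x"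

instantiation complex :: complex_normed_vector
begin

definition scaleC_complex :: "complex \<Rightarrow> complex \<Rightarrow> complex"
  where "scaleC_complex a x = a * x"

instance
  by standard (simp_all add: scaleC_complex_def algebra_simps norm_mult scaleR_conv_of_real)

end

typedef (overloaded) 'a cdual =
  "{f :: 'a::complex_normed_vector \<Rightarrow> complex. bounded_linear f \<and> (\<forall>c x. f (c *\<^sub>C x) = c * f x)}"
  morphisms cdual_apply Abs_cdual
  by (rule exI[of _ "\<lambda>_. 0"]) simp

setup_lifting type_definition_cdual

instantiation cdual :: (complex_normed_vector) complex_normed_vector
begin

(* onorm f is the supremum of norm (f x) / norm x (with 0 / 0 = 0), i.e. the usual dual norm. *)
lift_definition norm_cdual :: "'a cdual \<Rightarrow> real" is onorm .

lift_definition zero_cdual :: "'a cdual" is "\<lambda>x. 0"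
  by simp

lift_definition plus_cdual :: "'a cdual \<Rightarrow> 'a cdual \<Rightarrow> 'a cdual" is "\<lambda>f g x. f x + g x"
  by (auto simp: bounded_linear_add algebra_simps)

lift_definition minus_cdual :: "'a cdual \<Rightarrow> 'a cdual \<Rightarrow> 'a cdual" is "\<lambda>f g x. f x - g x"
  by (auto simp: bounded_linear_sub algebra_simps)

lift_definition uminus_cdual :: "'a cdual \<Rightarrow> 'a cdual" is "\<lambda>f x. - f x"
  by (auto simp: bounded_linear_minus)

lift_definition scaleR_cdual :: "real \<Rightarrow> 'a cdual \<Rightarrow> 'a cdual" is "\<lambda>r f x. r *\<^sub>R f x"
  by (auto intro: bounded_linear_compose[OF bounded_linear_scaleR_right])

lift_definition scaleC_cdual :: "complex \<Rightarrow> 'a cdual \<Rightarrow> 'a cdual" is "\<lambda>a f x. a * f x"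
  by (auto intro: bounded_linear_compose[OF bounded_linear_mult_right])

definition sgn_cdual :: "'a cdual \<Rightarrow> 'a cdual"
  where "sgn_cdual f = inverse (norm f) *\<^sub>R f"

definition dist_cdual :: "'a cdual \<Rightarrow> 'a cdual \<Rightarrow> real"
  where "dist_cdual f g = norm (f - g)"

definition uniformity_cdual :: "('a cdual \<times> 'a cdual) filter"
  where [code del]: "uniformity_cdual = (INF e\<in>{0<..}. principal {(f, g). dist f g < e})"

definition open_cdual :: "'a cdual set \<Rightarrow> bool"
  where [code del]:
    "open_cdual S = (\<forall>f\<in>S. \<forall>\<^sub>F (f', g) in uniformity. f' = f \<longrightarrow> g \<in> S)"

lemma onorm_scaleC_le:
  assumes "bounded_linear (f :: 'b::real_normed_vector \<Rightarrow> complex)"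
  shows "onorm (\<lambda>x. a * f x) \<le> cmod a * onorm f"
  by (rule onorm_bound)
    (use onorm[OF assms] in
      \<open>auto simp: norm_mult mult.assoc intro!: mult_left_mono mult_nonneg_nonneg onorm_pos_le[OF assms]\<close>)

lemma onorm_scaleC:
  assumes "bounded_linear (f :: 'b::real_normed_vector \<Rightarrow> complex)"
  shows "onorm (\<lambda>x. a * f x) = cmod a * onorm f"
proof (cases "a = 0")
  case True
  then show ?thesis by (simp add: onorm_zero)
next
  case False
  have "bounded_linear (\<lambda>x. a * f x)"
    using assms by (rule bounded_linear_compose[OF bounded_linear_mult_right])
  from onorm_scaleC_le[OF this, of "inverse a"] False
  have "onorm f \<le> inverse (cmod a) * onorm (\<lambda>x. a * f x)"
    by (simp add: mult.assoc[symmetric] norm_inverse)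
  with False have "cmod a * onorm f \<le> onorm (\<lambda>x. a * f x)"
    by (simp add: field_simps)
  with onorm_scaleC_le[OF assms, of a] show ?thesis by simp
qed

instance
proof
  fix f g :: "'a cdual" and r :: real and a b :: complex
  show "norm (f + g) \<le> norm f + norm g"
    by transfer (simp add: onorm_triangle)
  show "norm (r *\<^sub>R f) = \<bar>r\<bar> * norm f"
    by transfer (simp add: onorm_scaleR)
  show "norm f = 0 \<longleftrightarrow> f = 0"
    by transfer (auto simp: onorm_eq_0)
  show "norm (a *\<^sub>C f) = cmod a * norm f"
    by transfer (simp add: onorm_scaleC)
  show "of_real r *\<^sub>C f = r *\<^sub>R f"
    by transfer (simp add: scaleR_conv_of_real)
qed (unfold dist_cdual_def open_cdual_def sgn_cdual_def uniformity_cdual_def,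
  (rule refl | (transfer, simp add: algebra_simps fun_eq_iff))+)

end

(* Meaningful for delta, eps in [0, 1) with eps < (1 - delta)^2; these conditions are left to the
   places where the relation is used. *)
definition approx_orth :: "real \<Rightarrow> real \<Rightarrow> 'z::complex_normed_vector \<Rightarrow> 'z \<Rightarrow> bool"
  where "approx_orth \<delta> \<epsilon> u v \<longleftrightarrow>
    (\<exists>\<Gamma> :: 'z cdual. \<Gamma> \<noteq> 0 \<and>
      cmod (cdual_apply \<Gamma> u) \<ge> (1 - \<delta>) * norm \<Gamma> * norm u \<and>
      cmod (cdual_apply \<Gamma> v) \<le> \<epsilon> / (1 - \<delta>) * norm \<Gamma> * norm v)"

end

theory Submission
  imports Defs
begin

text \<open>
  The functional that witnesses \<open>f \<bottom> g\<close> is evaluation at \<open>x\<close>, an element of the bidual that sends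
  \<open>f\<close> to \<open>f x\<close> and \<open>g\<close> to \<open>g x\<close>. The two inequalities assumed for \<open>x\<close> become the two inequalities
  of \<open>approx_orth\<close> as soon as this functional has norm exactly 1: the bound on \<open>f\<close> needs norm at
  most 1, which is immediate, while the bound on \<open>g\<close>, and the fact that the functional is nonzero,
  need norm at least 1. The latter holds because some functional of norm at most 1 takes
  the value \<open>norm x\<close> at \<open>x\<close>, that is, by the Hahn--Banach theorem.

  Hahn--Banach is proved here for functionals dominated by a sublinear \<open>p\<close>, without extending
  functionals from subspaces. By Zorn's lemma there are minimal sublinear functionals below any
  given one. Each sublinear \<open>p\<close> can be lowered, for a chosen \<open>x\<close>, to a sublinear functional whose
  value at \<open>- x\<close> is at most \<open>- p x\<close> (\<open>sublinear_lowering\<close>). A minimal functional cannot be lowered,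
  so it is odd, and an odd sublinear functional is linear. Lowering \<open>p\<close> once at \<open>x\<close> before
  passing to a minimal functional forces the value \<open>p x\<close> at \<open>x\<close>. Finally, a real functional \<open>\<phi>\<close>
  is the real part of the complex functional \<open>x \<mapsto> \<phi> x - \<i> \<phi> (\<i> x)\<close>, which has the same
  norm bound.
\<close>

section \<open>Sublinear functionals and the Hahn--Banach theorem\<close>

definition sublinear :: "('a::real_vector \<Rightarrow> real) \<Rightarrow> bool"
  where "sublinear p \<longleftrightarrow>
    (\<forall>x y. p (x + y) \<le> p x + p y) \<and> (\<forall>r x. r \<ge> 0 \<longrightarrow> p (r *\<^sub>R x) = r * p x)"

lemma sublinear_add: "sublinear p \<Longrightarrow> p (x + y) \<le> p x + p y"
  and sublinear_scaleR: "sublinear p \<Longrightarrow> r \<ge> 0 \<Longrightarrow> p (r *\<^sub>R x) = r * p x"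
  by (auto simp: sublinear_def)

lemma sublinear_0: "sublinear p \<Longrightarrow> p 0 = 0"
  using sublinear_scaleR[of p 0 0] by simp

lemma sublinear_minus: "sublinear p \<Longrightarrow> - p (- x) \<le> p x"
  using sublinear_add[of p x "- x"] sublinear_0[of p] by simp

lemma sublinear_norm: "sublinear norm"
  by (simp add: sublinear_def norm_triangle_ineq)

text \<open>
  The inequality for the factor \<open>1 / r\<close> at the point \<open>r *\<^sub>R x\<close> is the reverse inequality for \<open>r\<close>,
  and the factors \<open>2\<close> and \<open>1 / 2\<close> at the point \<open>0\<close> give \<open>p 0 = 0\<close>.
\<close>

lemma sublinearI:
  assumes add: "\<And>x y. p (x + y) \<le> p x + p y"
    and scale: "\<And>r x. r > 0 \<Longrightarrow> p (r *\<^sub>R x) \<le> r * p x"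
  shows "sublinear p"
proof -
  have zero: "p 0 = 0"
    using scale[of 2 0] scale[of "1/2" 0] by simp
  have "p (r *\<^sub>R x) = r * p x" if "r \<ge> 0" for r x
  proof (cases "r = 0")
    case False
    with that have r: "r > 0" by simp
    then have "p x \<le> inverse r * p (r *\<^sub>R x)"
      using scale[of "inverse r" "r *\<^sub>R x"] by simp
    with r have "r * p x \<le> p (r *\<^sub>R x)"
      by (simp add: field_simps)
    with scale[OF r, of x] show ?thesis by simp
  qed (simp add: zero)
  with add show ?thesis by (simp add: sublinear_def)
qed

text \<open>
  The members of \<open>K\<close> need not be sublinear: it suffices that each sublinearity inequality
  holds up to replacing the member of \<open>K\<close> on the smaller side. In this form the lemma covers both a
  chain of sublinear functionals and the family of translates that defines the lowering of
  a single one.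
\<close>

lemma sublinear_INF:
  assumes ne: "K \<noteq> {}"
    and bdd: "\<And>y. bdd_below ((\<lambda>a. a y) ` K)"
    and add: "\<And>a b y z. a \<in> K \<Longrightarrow> b \<in> K \<Longrightarrow> \<exists>c\<in>K. c (y + z) \<le> a y + b z"
    and scale: "\<And>a r y. a \<in> K \<Longrightarrow> r > 0 \<Longrightarrow> \<exists>c\<in>K. c (r *\<^sub>R y) \<le> r * a y"
  shows "sublinear (\<lambda>y. INF a\<in>K. a y :: real)" (is "sublinear ?q")
proof (rule sublinearI)
  have le: "?q y \<le> a y" if "a \<in> K" for a y
    using bdd that by (rule cINF_lower)
  fix y z
  have *: "?q (y + z) \<le> a y + b z" if "a \<in> K" "b \<in> K" for a b
    using add[OF that, of y z] le[of _ "y + z"] order_trans by blast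
  have "?q (y + z) - a y \<le> ?q z" if "a \<in> K" for a
    using *[OF that] by (intro cINF_greatest[OF ne]) (simp add: algebra_simps)
  then have "?q (y + z) - ?q z \<le> ?q y"
    by (intro cINF_greatest[OF ne]) (simp add: algebra_simps)
  then show "?q (y + z) \<le> ?q y + ?q z" by simp
next
  fix r :: real and y
  assume r: "r > 0"
  have le: "?q y \<le> a y" if "a \<in> K" for a y
    using bdd that by (rule cINF_lower)
  have "?q (r *\<^sub>R y) \<le> r * a y" if "a \<in> K" for a
    using scale[OF that r, of y] le[of _ "r *\<^sub>R y"] order_trans by blast
  then have "?q (r *\<^sub>R y) / r \<le> ?q y"
    using r by (intro cINF_greatest[OF ne]) (simp add: field_simps)
  with r show "?q (r *\<^sub>R y) \<le> r * ?q y" by (simp add: field_simps)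
qed

text \<open>
  The functional \<open>q y = (INF t\<in>{0..}. p (y + t *\<^sub>R x) - t * p x)\<close> works: the term \<open>t = 0\<close>
  gives \<open>q \<le> p\<close>, and the term \<open>t = 1\<close> bounds its value at \<open>- x\<close>.
\<close>

lemma sublinear_lowering:
  assumes p: "sublinear p"
  obtains q where "sublinear q" "\<And>y. q y \<le> p y" "q (- x) \<le> - p x"
proof -
  define T where "T t = (\<lambda>y. p (y + t *\<^sub>R x) - t * p x)" for t
  define q where "q y = (INF a\<in>T ` {0..}. a y)" for y
  have lower: "- p (- y) \<le> T t y" if "t \<ge> 0" for t y
    using sublinear_add[OF p, of "y + t *\<^sub>R x" "- y"] sublinear_scaleR[OF p that, of x]
    by (simp add: T_def)
  have bdd: "bdd_below ((\<lambda>a. a y) ` T ` {0..})" for y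
    using lower[of _ y] by (auto intro!: bdd_belowI[of _ "- p (- y)"])
  have "sublinear q"
    unfolding q_def
  proof (rule sublinear_INF)
    show "T ` {0..} \<noteq> {}" by simp
  next
    fix a b y z
    assume "a \<in> T ` {0..}" "b \<in> T ` {0..}"
    then obtain s t where st: "s \<ge> 0" "t \<ge> 0" and ab: "a = T s" "b = T t" by auto
    have "T (s + t) (y + z) \<le> a y + b z"
      using sublinear_add[OF p, of "y + s *\<^sub>R x" "z + t *\<^sub>R x"]
      by (simp add: T_def ab algebra_simps)
    with st show "\<exists>c\<in>T ` {0..}. c (y + z) \<le> a y + b z" by fastforce
  next
    fix a y and r :: real
    assume "a \<in> T ` {0..}" and r: "r > 0"
    then obtain t where t: "t \<ge> 0" and a: "a = T t" by auto
    have "T (r * t) (r *\<^sub>R y) \<le> r * a y"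
      using sublinear_scaleR[OF p, of r "y + t *\<^sub>R x"] r
      by (simp add: T_def a algebra_simps)
    with r t show "\<exists>c\<in>T ` {0..}. c (r *\<^sub>R y) \<le> r * a y"
      by (intro bexI[of _ "T (r * t)"]) auto
  qed (fact bdd)
  moreover have le: "q y \<le> T t y" if "t \<ge> 0" for t y
    using cINF_lower[OF bdd[of y], of "T t"] that by (simp add: q_def)
  have "q y \<le> p y" for y
    using le[of 0 y] by (simp add: T_def)
  moreover have "q (- x) \<le> - p x"
    using le[of 1 "- x"] by (simp add: T_def sublinear_0[OF p])
  ultimately show ?thesis using that by blast
qed

text \<open>
  Zorn's lemma applies because a chain below \<open>p\<close> is bounded below pointwise by
  \<open>y \<mapsto> - p (- y)\<close>, so its pointwise infimum is again sublinear.
\<close>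

lemma minimal_sublinear_exists:
  assumes p: "sublinear p"
  obtains m where "sublinear m" "\<And>y. m y \<le> p y"
    "\<And>q. sublinear q \<Longrightarrow> (\<And>y. q y \<le> m y) \<Longrightarrow> q = m"
proof -
  define A where "A = {q. sublinear q \<and> q \<le> p}"
  define P where "P = (\<lambda>a b :: 'a \<Rightarrow> real. b \<le> a)"
  have "\<exists>m\<in>A. \<forall>a\<in>A. P m a \<longrightarrow> a = m"
  proof (rule predicate_Zorn)
    show "partial_order_on A (relation_of P A)"
      by (rule partial_order_on_relation_ofI) (auto simp: P_def)
  next
    fix C
    assume "C \<in> Chains (relation_of P A)"
    then have CA: "C \<subseteq> A" and tot: "\<And>a b. a \<in> C \<Longrightarrow> b \<in> C \<Longrightarrow> a \<le> b \<or> b \<le> a"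
      by (auto simp: Chains_def relation_of_def P_def)
    show "\<exists>u\<in>A. \<forall>a\<in>C. P a u"
    proof (cases "C = {}")
      case True
      then show ?thesis using p by (auto simp: A_def)
    next
      case False
      have bdd: "bdd_below ((\<lambda>a. a y) ` C)" for y
      proof (rule bdd_belowI2)
        fix a
        assume "a \<in> C"
        then have "sublinear a" "a (- y) \<le> p (- y)"
          using CA by (auto simp: A_def le_fun_def)
        then show "- p (- y) \<le> a y"
          using sublinear_minus[of a y] by linarith
      qed
      define u where "u y = (INF a\<in>C. a y)" for y
      have "sublinear u"
        unfolding u_def
      proof (rule sublinear_INF[OF False bdd])
        fix a b y z
        assume ab: "a \<in> C" "b \<in> C"
        have *: "sublinear a" "sublinear b" using ab CA by (auto simp: A_def)
        from tot[OF ab] show "\<exists>c\<in>C. c (y + z) \<le> a y + b z"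
        proof
          assume "a \<le> b"
          then have "a (y + z) \<le> a y + b z"
            using sublinear_add[OF *(1), of y z] le_funD[of a b z] by linarith
          with ab show ?thesis by blast
        next
          assume "b \<le> a"
          then have "b (y + z) \<le> a y + b z"
            using sublinear_add[OF *(2), of y z] le_funD[of b a y] by linarith
          with ab show ?thesis by blast
        qed
      next
        fix a y and r :: real
        assume "a \<in> C" "r > 0"
        then show "\<exists>c\<in>C. c (r *\<^sub>R y) \<le> r * a y"
          using CA by (intro bexI[of _ a]) (auto simp: A_def sublinear_scaleR)
      qed
      moreover have le: "u \<le> a" if "a \<in> C" for a
        using cINF_lower[OF bdd that] by (simp add: u_def le_fun_def)
      moreover have "u \<le> p"
        using False CA le by (force simp: A_def intro: order_trans)
      ultimately show ?thesis by (auto simp: A_def P_def)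
    qed
  qed
  then obtain m where "m \<in> A" and min: "\<And>a. a \<in> A \<Longrightarrow> a \<le> m \<Longrightarrow> a = m"
    by (auto simp: P_def)
  then have m: "sublinear m" "m \<le> p" by (auto simp: A_def)
  show ?thesis
  proof (rule that)
    show "q = m" if "sublinear q" "\<And>y. q y \<le> m y" for q
      using min[of q] that m(2) by (force simp: A_def le_fun_def intro: order_trans)
  qed (use m in \<open>auto simp: le_fun_def\<close>)
qed

lemma linear_if_sublinear_odd:
  assumes p: "sublinear p" and odd: "\<And>x. p (- x) = - p x"
  shows "linear p"
proof
  fix x y :: 'a and r :: real
  show "p (x + y) = p x + p y"
    using sublinear_add[OF p, of x y] sublinear_add[OF p, of "x + y" "- y"] odd[of y] by simp
  show "p (r *\<^sub>R x) = r *\<^sub>R p x"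
  proof (cases "r \<ge> 0")
    case False
    then show ?thesis
      using sublinear_scaleR[OF p, of "- r" x] odd[of "r *\<^sub>R x"] by simp
  qed (simp add: sublinear_scaleR[OF p])
qed

theorem hahn_banach_sublinear:
  assumes p: "sublinear p"
  obtains \<phi> where "linear \<phi>" "\<And>y. \<phi> y \<le> p y" "\<phi> x = p x"
proof -
  obtain p' where p': "sublinear p'" "\<And>y. p' y \<le> p y" "p' (- x) \<le> - p x"
    using sublinear_lowering[OF p] by blast
  obtain \<phi> where \<phi>: "sublinear \<phi>" "\<And>y. \<phi> y \<le> p' y"
    and min: "\<And>q. sublinear q \<Longrightarrow> (\<And>y. q y \<le> \<phi> y) \<Longrightarrow> q = \<phi>"
    using minimal_sublinear_exists[OF p'(1)] by blast
  have odd: "\<phi> (- y) = - \<phi> y" for y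
  proof -
    obtain q where "sublinear q" "\<And>z. q z \<le> \<phi> z" "q (- y) \<le> - \<phi> y"
      using sublinear_lowering[OF \<phi>(1)] by blast
    with min[of q] have "\<phi> (- y) \<le> - \<phi> y" by simp
    with sublinear_minus[OF \<phi>(1), of y] show ?thesis by simp
  qed
  have le: "\<phi> y \<le> p y" for y
    using \<phi>(2) p'(2) by (rule order_trans)
  moreover have "\<phi> x = p x"
    using le[of x] odd[of x] \<phi>(2)[of "- x"] p'(3) by simp
  ultimately show ?thesis
    using that linear_if_sublinear_odd[OF \<phi>(1) odd] by blast
qed

section \<open>Norming functionals on complex normed spaces\<close>

lemma cdual_bounded_linear: "bounded_linear (cdual_apply f)"
  and cdual_scaleC: "cdual_apply f (c *\<^sub>C x) = c * cdual_apply f x"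
  using cdual_apply[of f] by auto

lemma cdual_norm_le: "cmod (cdual_apply f x) \<le> norm f * norm x"
  unfolding norm_cdual.rep_eq by (rule onorm[OF cdual_bounded_linear])

text \<open>
  For a functional \<open>F\<close> that is linear over the complex numbers, a bound on its real part bounds its
  modulus, since a unimodular multiple of \<open>x\<close> turns the value at \<open>x\<close> into its modulus.
\<close>

lemma complexification_of_real_functional:
  fixes \<phi> :: "'a::complex_normed_vector \<Rightarrow> real"
  assumes lin: "linear \<phi>" and le: "\<And>y. \<phi> y \<le> norm y"
  obtains h :: "'a cdual" where "norm h \<le> 1" "\<And>y. Re (cdual_apply h y) = \<phi> y"
proof -
  define F where "F y = Complex (\<phi> y) (- \<phi> (\<i> *\<^sub>C y))" for y
  have add: "F (y + z) = F y + F z" for y z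
    by (simp add: F_def complex_eq_iff scaleC_add_right linear_add[OF lin])
  have decomp: "c *\<^sub>C y = Re c *\<^sub>R y + Im c *\<^sub>R (\<i> *\<^sub>C y)" for c and y :: 'a
  proof -
    have "c *\<^sub>C y = (of_real (Re c) + of_real (Im c) * \<i>) *\<^sub>C y"
      by (rule arg_cong[where f = "\<lambda>d. d *\<^sub>C y"]) (simp add: complex_eq_iff)
    also have "\<dots> = Re c *\<^sub>R y + Im c *\<^sub>R (\<i> *\<^sub>C y)"
      by (simp only: scaleC_add_left flip: scaleC_of_real scaleC_scaleC)
    finally show ?thesis .
  qed
  have \<phi>_scaleC: "\<phi> (c *\<^sub>C y) = Re c * \<phi> y + Im c * \<phi> (\<i> *\<^sub>C y)" for c y
    by (simp add: decomp[of c] linear_add[OF lin] linear_scale[OF lin])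
  have scaleC: "F (c *\<^sub>C y) = c * F y" for c y
    using \<phi>_scaleC[of c y] \<phi>_scaleC[of "\<i> * c" y]
    by (simp add: F_def complex_eq_iff scaleC_scaleC)
  have bound: "cmod (F y) \<le> norm y" for y
  proof (cases "F y = 0")
    case False
    define c where "c = of_real (cmod (F y)) / F y"
    have c: "cmod c = 1" using False by (simp add: c_def norm_divide)
    have "cmod (F y) = Re (F (c *\<^sub>C y))"
      using False by (simp add: scaleC c_def)
    also have "\<dots> \<le> norm (c *\<^sub>C y)" by (simp add: F_def le)
    finally show ?thesis by (simp add: norm_scaleC c)
  qed simp
  have "bounded_linear F"
  proof (rule bounded_linear_intro)
    show "F (r *\<^sub>R y) = r *\<^sub>R F y" for r y
      using scaleC[of "of_real r" y] by (simp add: scaleC_of_real scaleR_conv_of_real)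
    show "norm (F y) \<le> norm y * 1" for y using bound by simp
  qed (rule add)
  then have h: "cdual_apply (Abs_cdual F) = F"
    by (simp add: Abs_cdual_inverse scaleC)
  show ?thesis
  proof (rule that)
    show "norm (Abs_cdual F) \<le> 1"
      unfolding norm_cdual.rep_eq h by (rule onorm_bound) (simp_all add: bound)
    show "Re (cdual_apply (Abs_cdual F) y) = \<phi> y" for y
      by (simp add: h F_def)
  qed
qed

lemma norming_functional_exists:
  fixes x :: "'a::complex_normed_vector"
  obtains h :: "'a cdual" where "norm h \<le> 1" "norm x \<le> cmod (cdual_apply h x)"
proof -
  obtain \<phi> where \<phi>: "linear \<phi>" "\<And>y. \<phi> y \<le> norm y" "\<phi> x = norm x"
    using hahn_banach_sublinear[OF sublinear_norm] by blast
  then obtain h where h: "norm h \<le> 1" "\<And>y. Re (cdual_apply h y) = \<phi> y"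
    using complexification_of_real_functional by blast
  have "norm x \<le> cmod (cdual_apply h x)"
    using complex_Re_le_cmod[of "cdual_apply h x"] h(2)[of x] \<phi>(3) by simp
  with h(1) show ?thesis by (rule that)
qed

section \<open>The isometric embedding into the bidual\<close>

lift_definition cdual_eval :: "'a::complex_normed_vector \<Rightarrow> 'a cdual cdual"
  is "\<lambda>x f. cdual_apply f x"
proof (intro conjI allI)
  fix x :: 'a
  show "bounded_linear (\<lambda>f. cdual_apply f x)"
  proof (rule bounded_linear_intro)
    show "norm (cdual_apply f x) \<le> norm f * norm x" for f
      by (rule cdual_norm_le)
  qed (simp_all add: plus_cdual.rep_eq scaleR_cdual.rep_eq)
qed (simp add: scaleC_cdual.rep_eq)

lemma norm_cdual_eval: "norm (cdual_eval x) = norm x"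
proof (rule antisym)
  show "norm (cdual_eval x) \<le> norm x"
    unfolding norm_cdual.rep_eq
    by (rule onorm_bound) (simp_all add: cdual_eval.rep_eq cdual_norm_le mult.commute[of "norm x"])
  obtain h :: "'a cdual" where h: "norm h \<le> 1" "norm x \<le> cmod (cdual_apply h x)"
    by (rule norming_functional_exists)
  have "norm x \<le> norm (cdual_eval x) * norm h"
    using h(2) cdual_norm_le[of "cdual_eval x" h] by (simp add: cdual_eval.rep_eq)
  also have "\<dots> \<le> norm (cdual_eval x)"
    using h(1) by (simp add: mult_left_le)
  finally show "norm x \<le> norm (cdual_eval x)" .
qed

theorem theorem1p7:
  fixes f g :: "'a::{complex_normed_vector, banach} cdual"
    and \<delta> \<epsilon> :: real
  assumes "\<delta> \<in> {0..<1}" and "\<epsilon> \<in> {0..<1}" and "\<epsilon> < (1 - \<delta>)\<^sup>2"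
    and "\<exists>x\<in>sphere 0 1. cmod (cdual_apply f x) \<ge> (1 - \<delta>) * norm f \<and>
           cmod (cdual_apply g x) \<le> \<epsilon> / (1 - \<delta>) * norm g"
  shows "approx_orth \<delta> \<epsilon> f g"
proof -
  obtain x where x: "norm x = 1" "cmod (cdual_apply f x) \<ge> (1 - \<delta>) * norm f"
    "cmod (cdual_apply g x) \<le> \<epsilon> / (1 - \<delta>) * norm g"
    using assms(4) by auto
  have "norm (cdual_eval x) = 1"
    by (simp add: norm_cdual_eval x(1))
  moreover from this have "cdual_eval x \<noteq> 0"
    by auto
  ultimately show ?thesis
    unfolding approx_orth_def using x(2,3)
    by (intro exI[of _ "cdual_eval x"]) (simp add: cdual_eval.rep_eq)
qed

end
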